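(* Consider the tripartite signature protocol between Alice, Bob and Charlie described in the context, used to sign documents of $b_M$ bits with $b_H$-bit hashes, where the authenticated channel uses $b'_H$-bit tags. If $b_M>b_H$, then the protocol is $\varepsilon_{\rm rep}$-secure against repudiation attacks with $$\varepsilon_{\rm rep}=\frac{2b_H+b_M}{2^{b'_H-1}},$$ i.e. the probability that the protocol does not abort and that Charlie rejects a document-signature pair accepted by Bob is at most $\varepsilon_{\rm rep}$.
   Context: **LFSR hash family $\mathcal{F}_{\rm AXU}$.** For a bit string $p=(p_{n-1},\dots,p_0)$ with $n=b_H$, let $p(x)=x^n+p_{n-1}x^{n-1}+\dots+p_1x+p_0$ over GF(2). Given an initial state $s=(s_{n-1},\dots,s_0)$, $s\ne0$, the linear feedback shift register (LFSR) with connection polynomial $p(x)$ generates bits $s_l=\sum_{i=0}^{n-1}p_i s_{l-n+i} \bmod 2$ for $l\ge n$, and its $k$-th state is $s^k=(s_{n-1+k},\dots,s_k)^T$. For $p(x)$ irreducible, $T_{p,s}$ is the $b_H\times b_M$ Toeplitz matrix with columns $(s^0,s^1,\dots,s^{b_M-1})$, and the hash of a $b_M$-bit message $m$ is $T_{p,s}\cdot m \bmod 2$. The family satisfies $\Pr[f(m_1)\oplus f(m_2)=b]\le b_M2^{1-b_H}$ for all $m_1\ne m_2$ and all $b$, for $f$ uniformly random in the family. **Authenticated channel.** It is reliable (no message is lost) and implemented by Wegman–Carter authentication with key recycling: the two users share a secret random function $f$ of the family $\mathcal{F}_{\rm AXU}$ with $b'_H$-bit outputs, and each message $m$ is sent with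 tag $f(m)\oplus k$, with $k$ a fresh secret uniformly random $b'_H$-bit string. A modification of a $b$-bit message is accepted as authentic with probability at most $b/2^{b'_H-1}$. Failure to authenticate any message aborts the protocol (this is not the same as rejecting the signature). **Protocol.** 1. Distribution: Alice, Bob, Charlie obtain (perfectly) secret uniformly random $3b_H$-bit keys $X_A,X_B,X_C$ with $X_A=X_B\oplus X_C$. Each is split as $X=X^{b_H}\|X^{2b_H}$ (first $b_H$ bits and last $2b_H$ bits). 2. Signing: Alice draws a random $b_H$-bit string $p_a$ (redrawing until the polynomial $p_a(x)$ is irreducible), computes $h_a=T_{p_a,X_A^{b_H}}\cdot Doc$, the digest $Dig=(h_a\|p_a)$, and $Sig=Dig\oplus X_A^{2b_H}$. She sends $\{Doc,Sig\}$ to Bob over a public channel. 3. Bob's verification: Bob sends $\{Doc,Sig\}$ and $X_B$ to Charlie over the authenticated channel; after receiving these Charlie sends $X_C$ to Bob over the same channel. Bob computes $K_B=X_B\oplus X_C$, decrypts $(h_b\|p_b)=Sig\oplus K_B^{2b_H}$, and accepts iff $h_b=T_{p_b,K_B^{b_H}}\cdot Doc$; he informs Charlie of his outcome with one bit over the authenticated channel. 4. Charlie's verification: Charlie computes $K_C=X_C\oplus X_B$ from the received $X_B$, decrypts $(h_c\|p_c)=Sig\oplus K_C^{2b_H}$ from the received $Sig$, and accepts iff $h_c=T_{p_c,K_C^{b_H}}\cdot Doc$ (regardless of Bob's outcome). **Repudiation attack.** Bob and Charlie are honest; Alice is malicious and computationally unbounded. She may send an arbitrary pair to Bob and may attempt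 to tamper with messages on the authenticated channel between Bob and Charlie. *)

theory Defs
  imports
    "HOL-Probability.Probability_Mass_Function"
    "HOL-Computational_Algebra.Polynomial"
    "HOL-Library.Z2"
    "HOL-Library.Monad_Syntax"
    "Jordan_Normal_Form.Matrix"
begin

text \<open>
  Bit strings are vectors over the field \<^typ>\<open>bit\<close> = GF(2), so that XOR is vector addition.
  Strings are written with the highest index first, as in \<open>(s\<^sub>n\<^sub>-\<^sub>1, \<dots>, s\<^sub>0)\<close>: the bit with
  subscript \<open>i\<close> of an \<open>n\<close>-bit string \<open>s\<close> is \<open>s $ (n - 1 - i)\<close>.
\<close>

type_synonym bits = "bit vec"

definition sub_bit :: "bits \<Rightarrow> nat \<Rightarrow> bit" where
  "sub_bit s i = s $ (dim_vec s - 1 - i)"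

definition uniform_bits :: "nat \<Rightarrow> bits pmf" where
  "uniform_bits n = pmf_of_set (carrier_vec n)"


section \<open>The LFSR-based Toeplitz hash family\<close>

definition conn_poly :: "bits \<Rightarrow> bit poly" where
  "conn_poly p = monom 1 (dim_vec p) + (\<Sum>i<dim_vec p. monom (sub_bit p i) i)"

function lfsr_bit :: "bits \<Rightarrow> bits \<Rightarrow> nat \<Rightarrow> bit" where
  "lfsr_bit p s l =
     (if l < dim_vec p then sub_bit s l
      else (\<Sum>i<dim_vec p. sub_bit p i * lfsr_bit p s (l - dim_vec p + i)))"
  by pat_completeness auto
termination
  by (relation "Wellfounded.measure (\<lambda>(p, s, l). l)") auto

declare lfsr_bit.simps [simp del]

definition lfsr_state :: "bits \<Rightarrow> bits \<Rightarrow> nat \<Rightarrow> bits" where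
  "lfsr_state p s k = (let n = dim_vec p in vec n (\<lambda>j. lfsr_bit p s (n - 1 - j + k)))"

definition toeplitz :: "bits \<Rightarrow> bits \<Rightarrow> nat \<Rightarrow> bit mat" where
  "toeplitz p s b = mat_of_cols (dim_vec p) (map (lfsr_state p s) [0..<b])"

text \<open>
  A member of the family is given by its seed \<open>(p, s)\<close>, which defines a hash function on messages
  of every length.
\<close>

type_synonym seed = "bits \<times> bits"

definition axu_seeds :: "nat \<Rightarrow> seed set" where
  "axu_seeds n = {(p, s). p \<in> carrier_vec n \<and> irreducible (conn_poly p) \<and>
                          s \<in> carrier_vec n \<and> s \<noteq> 0\<^sub>v n}"

definition axu_hash :: "seed \<Rightarrow> bits \<Rightarrow> bits" where
  "axu_hash f m = (case f of (p, s) \<Rightarrow> toeplitz p s (dim_vec m) *\<^sub>v m)"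


section \<open>Wegman--Carter authentication\<close>

type_synonym packet = "bits \<times> bits"

definition auth_packet :: "seed \<Rightarrow> bits \<Rightarrow> bits \<Rightarrow> packet" where
  "auth_packet f k m = (m, axu_hash f m + k)"

text \<open>
  The receiver knows from the protocol which message length \<open>n\<close> to expect. The length has to be
  checked: appending zeros to a message does not change its hash.
\<close>

definition authentic :: "seed \<Rightarrow> bits \<Rightarrow> nat \<Rightarrow> packet \<Rightarrow> bool" where
  "authentic f k n c \<longleftrightarrow> fst c \<in> carrier_vec n \<and> snd c = axu_hash f (fst c) + k"


section \<open>The signature protocol under a repudiation attack\<close>

text \<open>\<open>K\<close> is the verifier's reconstruction of Alice's key.\<close>

definition accepts :: "nat \<Rightarrow> nat \<Rightarrow> bits \<Rightarrow> bits \<Rightarrow> bits \<Rightarrow> bool" where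
  "accepts bM bH K doc sig \<longleftrightarrow>
     doc \<in> carrier_vec bM \<and> sig \<in> carrier_vec (2 * bH) \<and>
     (let dig = sig + vec_last K (2 * bH);
          h = vec_first dig bH;
          p = vec_last dig bH
      in h = toeplitz p (vec_first K bH) bM *\<^sub>v doc)"

text \<open>
  Malicious Alice is an arbitrary randomized strategy with private memory of type \<open>'st\<close>. She
  picks the document-signature pair from her key; afterwards she sees every packet on the channel
  between Bob and Charlie and replaces it by a packet of her choice. Bob's first two packets
  (the pair, and his key) are sent one after the other, so she may see both of them before
  delivering the first one.
\<close>

record 'st adversary =
  adv_sign    :: "bits \<Rightarrow> (bits \<times> bits \<times> 'st) pmf"
  adv_pair    :: "'st \<Rightarrow> packet \<Rightarrow> packet \<Rightarrow> (packet \<times> 'st) pmf"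
  adv_key_B   :: "'st \<Rightarrow> (packet \<times> 'st) pmf"
  adv_key_C   :: "'st \<Rightarrow> packet \<Rightarrow> (packet \<times> 'st) pmf"
  adv_outcome :: "'st \<Rightarrow> packet \<Rightarrow> packet pmf"

datatype outcome = Aborted | Completed (bob_accepts: bool) (charlie_accepts: bool)

text \<open>
  Here \<open>c\<^sub>i\<close> is the packet sent and \<open>d\<^sub>i\<close> the packet received. The seed \<open>f\<close> is used for all
  messages, whereas each message has its own one-time pad \<open>k\<^sub>i\<close>.
\<close>

definition protocol_run :: "nat \<Rightarrow> nat \<Rightarrow> nat \<Rightarrow> 'st adversary \<Rightarrow> outcome pmf" where
  "protocol_run bM bH bH' A = do {
     X\<^sub>B \<leftarrow> uniform_bits (3 * bH);
     X\<^sub>C \<leftarrow> uniform_bits (3 * bH);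
     let X\<^sub>A = X\<^sub>B + X\<^sub>C;
     f \<leftarrow> pmf_of_set (axu_seeds bH');
     k\<^sub>1 \<leftarrow> uniform_bits bH';
     k\<^sub>2 \<leftarrow> uniform_bits bH';
     k\<^sub>3 \<leftarrow> uniform_bits bH';
     k\<^sub>4 \<leftarrow> uniform_bits bH';
     (doc, sig, st\<^sub>0) \<leftarrow> adv_sign A X\<^sub>A;
     let c\<^sub>1 = auth_packet f k\<^sub>1 (doc @\<^sub>v sig);
     let c\<^sub>2 = auth_packet f k\<^sub>2 X\<^sub>B;
     (d\<^sub>1, st\<^sub>1) \<leftarrow> adv_pair A st\<^sub>0 c\<^sub>1 c\<^sub>2;
     if \<not> authentic f k\<^sub>1 (bM + 2 * bH) d\<^sub>1 then return_pmf Aborted else do {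
     (d\<^sub>2, st\<^sub>2) \<leftarrow> adv_key_B A st\<^sub>1;
     if \<not> authentic f k\<^sub>2 (3 * bH) d\<^sub>2 then return_pmf Aborted else do {
     let c\<^sub>3 = auth_packet f k\<^sub>3 X\<^sub>C;
     (d\<^sub>3, st\<^sub>3) \<leftarrow> adv_key_C A st\<^sub>2 c\<^sub>3;
     if \<not> authentic f k\<^sub>3 (3 * bH) d\<^sub>3 then return_pmf Aborted else do {
     let bob = accepts bM bH (X\<^sub>B + fst d\<^sub>3) doc sig;
     let c\<^sub>4 = auth_packet f k\<^sub>4 (vec 1 (\<lambda>_. of_bool bob));
     d\<^sub>4 \<leftarrow> adv_outcome A st\<^sub>3 c\<^sub>4;
     if \<not> authentic f k\<^sub>4 1 d\<^sub>4 then return_pmf Aborted else do {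
     let charlie = accepts bM bH (X\<^sub>C + fst d\<^sub>2)
                     (vec_first (fst d\<^sub>1) bM) (vec_last (fst d\<^sub>1) (2 * bH));
     return_pmf (Completed bob charlie)
     }}}}
   }"

text \<open>The first argument only fixes the type of the adversary's memory.\<close>

definition repudiation_secure :: "'st itself \<Rightarrow> nat \<Rightarrow> nat \<Rightarrow> nat \<Rightarrow> real \<Rightarrow> bool" where
  "repudiation_secure _ bM bH bH' \<epsilon> \<longleftrightarrow>
     (\<forall>A :: 'st adversary.
        measure_pmf.prob (protocol_run bM bH bH' A)
          {r. r \<noteq> Aborted \<and> bob_accepts r \<and> \<not> charlie_accepts r} \<le> \<epsilon>)"

end

theory Submission
  imports Defs "HOL-Computational_Algebra.Polynomial_Factorial"
begin

text \<open>
  A repudiation requires that the first modified packet among the pair, \<open>X\<^sub>B\<close> and \<open>X\<^sub>C\<close> is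
  accepted: if none is modified, Bob and Charlie evaluate the same predicate on the same data. Up to
  that packet the one-time pads make the attacker's view independent of the hash function, so the
  events of the first forgery at the different packets are disjoint and the largest single-packet
  bound is a bound for the whole run; \<open>bM > bH\<close> makes the pair the longest message.

  A forgery succeeds only if the hash function maps a fixed nonzero message \<open>m\<close> of length \<open>L\<close> to
  a fixed value. Let polynomials act on bit sequences by shifts. The hash of \<open>m\<close> consists of the
  first bits of the LFSR sequence acted on by \<open>m(x)\<close>. It vanishes iff the irreducible \<open>p(x)\<close>
  divides \<open>m(x)\<close>, and otherwise the hash is injective in the initial state. At most \<open>(L - 1) / n\<close>
  irreducible polynomials of degree \<open>n\<close> divide \<open>m(x)\<close>, and there are at least
  \<open>2 ^ (n - 1) / n\<close> of them, because \<open>X ^ 2 ^ n - X\<close> is squarefree and its irreducible factors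
  have degrees dividing \<open>n\<close>.
\<close>

subsection \<open>Irreducible polynomials over GF(2)\<close>

lemma prime_elem_dvd_prodD:
  assumes "prime_elem p" "finite A" "p dvd \<Prod>A"
  shows "\<exists>a\<in>A. p dvd a"
  using assms(2,3)
proof (induction A)
  case empty
  then show ?case
    using assms(1) by (simp add: prime_elem_def)
next
  case (insert x A)
  then show ?case
    using prime_elem_dvd_multD[OF assms(1), of x "\<Prod>A"] by auto
qed

text \<open>Lagrange's root bound in the domain modulo \<open>P\<close>, without forming the
  quotient: after one root \<open>a\<close> is split off by synthetic division, the other roots are
  incongruent to \<open>a\<close>, so primality moves the divisibility to the quotient
  polynomial.\<close>

lemma card_roots_mod_prime_le:
  fixes Q :: "'a :: idom poly"
  assumes "prime_elem P" "finite S"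
    and "\<not> P dvd lead_coeff Q"
    and "\<And>a. a \<in> S \<Longrightarrow> P dvd poly Q a"
    and "\<And>a b. a \<in> S \<Longrightarrow> b \<in> S \<Longrightarrow> P dvd a - b \<Longrightarrow> a = b"
  shows "card S \<le> degree Q"
  using assms(2-)
proof (induction "degree Q" arbitrary: Q S)
  case 0
  then obtain c where Q: "Q = [:c:]"
    by (metis degree_eq_zeroE)
  with 0 have "S = {}"
    by auto
  then show ?case by simp
next
  case (Suc n)
  show ?case
  proof (cases "S = {}")
    case False
    then obtain a where a: "a \<in> S"
      by blast
    define Q' where "Q' = synthetic_div Q a"
    have Q: "Q = [:-a, 1:] * Q' + [:poly Q a:]"
      unfolding Q'_def by (rule synthetic_div_correct'[symmetric])
    have deg: "degree Q' = n"
      using Suc.hyps(2) by (simp add: Q'_def degree_synthetic_div)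
    have "lead_coeff Q = lead_coeff Q'"
    proof -
      have "coeff Q (Suc n) = coeff Q' n - a * coeff Q' (Suc n)"
        by (subst Q) (simp add: coeff_pCons)
      moreover have "coeff Q' (Suc n) = 0"
        using deg by (simp add: coeff_eq_0)
      ultimately show ?thesis
        using deg Suc.hyps(2) by simp
    qed
    moreover have "P dvd poly Q' b" if "b \<in> S - {a}" for b
    proof -
      have "poly Q b = (b - a) * poly Q' b + poly Q a"
        by (subst Q) (simp add: algebra_simps)
      then have "P dvd (b - a) * poly Q' b"
        using Suc.prems(3)[of a] Suc.prems(3)[of b] a that
        by (metis DiffD1 add_diff_cancel_right' dvd_diff)
      moreover have "\<not> P dvd b - a"
        using Suc.prems(4)[of b a] a that by auto
      ultimately show ?thesis
        using assms(1) by (meson prime_elem_dvd_multD)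
    qed
    ultimately have "card (S - {a}) \<le> degree Q'"
      using Suc.prems deg by (intro Suc.hyps(1)) auto
    then show ?thesis
      using a deg Suc.hyps(2) Suc.prems(1) by (simp add: card_Diff_singleton)
  qed simp
qed

section \<open>Arithmetic of polynomials in characteristic 2\<close>

lemma bit_poly_numeral_Bit0 [simp]: "numeral (Num.Bit0 k) = (0 :: bit poly)"
  unfolding numeral_poly by simp

lemma bit_poly_add_self [simp]: "p + p = (0 :: bit poly)"
  by (simp flip: mult_2)

lemma bit_poly_diff [simp]: "p - q = p + (q :: bit poly)"
  by (rule poly_eqI) simp

lemma bit_poly_power_two_power_add: "(p + q) ^ 2 ^ n = p ^ 2 ^ n + (q :: bit poly) ^ 2 ^ n"
proof (induction n)
  case (Suc n)
  have "(p + q) ^ 2 ^ Suc n = ((p + q) ^ 2 ^ n)\<^sup>2"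
    by (simp add: power_mult[symmetric] mult.commute)
  also have "\<dots> = (p ^ 2 ^ n)\<^sup>2 + (q ^ 2 ^ n)\<^sup>2 + (p ^ 2 ^ n * q ^ 2 ^ n + p ^ 2 ^ n * q ^ 2 ^ n)"
    unfolding Suc by (simp only: power2_eq_square algebra_simps)
  finally show ?case
    by (simp add: power_mult[symmetric] mult.commute)
qed simp

text \<open>The condition is on coefficients, not on the degree, so that \<open>n = 0\<close> leaves
  only the zero polynomial and the induction follows \<open>pCons\<close>.\<close>

lemma card_bit_polys_below:
  "finite {g :: bit poly. \<forall>i\<ge>n. coeff g i = 0} \<and> card {g :: bit poly. \<forall>i\<ge>n. coeff g i = 0} = 2 ^ n"
proof (induction n)
  case 0
  have "{g :: bit poly. \<forall>i\<ge>0. coeff g i = 0} = {0}"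
    by (auto simp: poly_eq_iff)
  then show ?case by simp
next
  case (Suc n)
  let ?B = "\<lambda>n. {g :: bit poly. \<forall>i\<ge>n. coeff g i = 0}"
  have bit: "(UNIV :: bit set) = {0, 1}"
    by (auto intro: bit.exhaust)
  have "?B (Suc n) = case_prod pCons ` (UNIV \<times> ?B n)"
  proof (intro equalityI subsetI)
    fix g assume g: "g \<in> ?B (Suc n)"
    obtain a h where "g = pCons a h"
      by (rule pCons_cases)
    with g show "g \<in> case_prod pCons ` (UNIV \<times> ?B n)"
      by (force simp: coeff_pCons split: nat.splits)
  qed (auto simp: coeff_pCons split: nat.splits)
  moreover have "inj_on (case_prod pCons) ((UNIV :: bit set) \<times> ?B n)"
    by (auto simp: inj_on_def)
  ultimately show ?case
    using Suc by (simp add: card_image card_cartesian_product bit)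
qed

lemma bit_polys_degree_less:
  "n > 0 \<Longrightarrow> {g :: bit poly. \<forall>i\<ge>n. coeff g i = 0} = {g. degree g < n}"
  by (auto simp: coeff_eq_0) (metis le_degree leI not_less0 leading_coeff_0_iff degree_0)

lemma bit_poly_lead_coeff: "g \<noteq> 0 \<Longrightarrow> lead_coeff (g :: bit poly) = 1"
  by (metis bit_not_one_iff leading_coeff_0_iff)

lemma bit_poly_is_unit_iff: "is_unit (g :: bit poly) \<longleftrightarrow> g = 1"
proof
  assume "is_unit g"
  then have "degree g = 0" "g \<noteq> 0"
    using dvd_imp_degree_le[of g 1] by auto
  then show "g = 1"
    using bit_poly_lead_coeff[of g] by (auto elim!: degree_eq_zeroE simp: one_pCons)
qed simp

lemma bit_poly_irreducible_dvd_irreducible: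
  fixes P Q :: "bit poly"
  assumes "irreducible P" "irreducible Q" "P dvd Q"
  shows "P = Q"
proof -
  obtain c where c: "Q = P * c"
    using assms(3) by blast
  then have "is_unit P \<or> is_unit c"
    using assms(2) irreducibleD by blast
  then show ?thesis
    using c assms(1) by (auto simp: bit_poly_is_unit_iff)
qed

lemma irreducible_degree_pos: "irreducible (P :: 'a :: field poly) \<Longrightarrow> degree P > 0"
  by (metis gr0I irreducible_def is_unit_iff_degree)

section \<open>Irreducible factors of \<open>X ^ 2 ^ n - X\<close>\<close>

abbreviation frob_poly :: "nat \<Rightarrow> bit poly" where
  "frob_poly n \<equiv> monom 1 (2 ^ n) + monom 1 1"

text \<open>Additivity of iterated squaring makes division with remainder possible on the exponents
  \<open>n\<close>.\<close>

lemma frob_poly_add: "frob_poly (a + b) = frob_poly a ^ 2 ^ b + frob_poly b"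
  by (simp add: bit_poly_power_two_power_add monom_power power_add algebra_simps)

lemma degree_frob_poly: "n > 0 \<Longrightarrow> degree (frob_poly n) = 2 ^ n"
  by (subst degree_add_eq_left) (use one_less_power[of "2::nat" n] in \<open>auto simp: degree_monom_eq\<close>)

text \<open>Fermat's little theorem for the class of \<open>X\<close> in the residue field modulo
  \<open>P\<close>. If \<open>P\<close> divides \<open>X\<close>, this class is zero and both terms
  are multiples of \<open>P\<close>.\<close>

lemma irreducible_dvd_frob_poly_degree:
  fixes P :: "bit poly"
  assumes "irreducible P"
  shows "P dvd frob_poly (degree P)"
proof (cases "P dvd monom 1 1")
  case True
  then show ?thesis
    using irreducible_degree_pos[OF assms]
    by (metis dvd_add dvd_power dvd_trans monom_power mult_1 power_one zero_less_numeral zero_less_power)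
next
  case False
  let ?X = "monom 1 1 :: bit poly"
  define d where "d = degree P"
  have prime: "prime_elem P"
    using assms by (rule field_poly_irreducible_imp_prime)
  have d: "d > 0"
    using irreducible_degree_pos[OF assms] by (simp add: d_def)
  define R where "R = {g. degree g < d} - {0 :: bit poly}"
  have fin: "finite R" and card: "card R = 2 ^ d - 1"
    using card_bit_polys_below[of d] bit_polys_degree_less[OF d] d
    by (auto simp: R_def card_Diff_singleton)
  have ndvd: "\<not> P dvd g" if "g \<in> R" for g
    using that by (auto simp: R_def d_def dest: dvd_imp_degree_le)
  \<comment> \<open>Multiplication by \<open>X\<close> permutes the nonzero residues, so \<open>X ^ (2 ^ d - 1) \<equiv> 1\<close>.\<close>
  define \<phi> where "\<phi> g = (?X * g) mod P" for g
  have P0: "P \<noteq> 0"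
    using prime by auto
  have range: "\<phi> ` R \<subseteq> R"
  proof
    fix h assume "h \<in> \<phi> ` R"
    then obtain g where g: "g \<in> R" "h = \<phi> g"
      by blast
    have "\<not> P dvd ?X * g"
      using ndvd[OF g(1)] False prime by (meson prime_elem_dvd_multD)
    then show "h \<in> R"
      using g degree_mod_less[OF P0, of "?X * g"]
      by (auto simp: R_def \<phi>_def d_def mod_eq_0_iff_dvd)
  qed
  have "inj_on \<phi> R"
  proof
    fix g h assume gh: "g \<in> R" "h \<in> R" "\<phi> g = \<phi> h"
    then have "P dvd ?X * (g - h)"
      by (simp only: \<phi>_def mod_eq_dvd_iff right_diff_distrib)
    then have "P dvd g - h"
      using False prime by (meson prime_elem_dvd_multD)
    moreover have "degree (g - h) < d"
      using gh by (intro degree_diff_less) (auto simp: R_def)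
    ultimately show "g = h"
      by (metis d_def dvd_imp_degree_le linorder_not_less right_minus_eq)
  qed
  then have bij: "\<phi> ` R = R"
    using endo_inj_surj[OF fin range] by blast
  have "(\<Prod>g\<in>R. ?X * g) mod P = (\<Prod>g\<in>R. \<phi> g) mod P"
    unfolding \<phi>_def by (simp add: mod_prod_eq)
  also have "(\<Prod>g\<in>R. \<phi> g) = \<Prod>R"
    using prod.reindex[OF \<open>inj_on \<phi> R\<close>, of id] bij by simp
  finally have "P dvd (\<Prod>g\<in>R. ?X * g) - \<Prod>R"
    by (simp only: mod_eq_dvd_iff)
  also have "(\<Prod>g\<in>R. ?X * g) - \<Prod>R = (?X ^ card R - 1) * \<Prod>R"
    by (simp only: prod.distrib prod_constant) (simp add: algebra_simps)
  finally have "P dvd ?X ^ card R - 1 \<or> P dvd \<Prod>R"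
    by (rule prime_elem_dvd_multD[OF prime])
  moreover have "\<not> P dvd \<Prod>R"
    using prime_elem_dvd_prodD[OF prime fin] ndvd by blast
  ultimately have "P dvd ?X * (?X ^ card R - 1)"
    by simp
  also have "?X * (?X ^ card R - 1) = ?X ^ Suc (card R) - ?X"
    by (simp only: right_diff_distrib power_Suc mult_1_right)
  also have "Suc (card R) = 2 ^ d"
    by (simp add: card)
  finally show ?thesis
    by (simp add: monom_power d_def)
qed

text \<open>The class of \<open>X\<close> generates the residue ring, so once \<open>r\<close>
  squarings fix \<open>X\<close> they fix every residue. There cannot be more residues than roots of
  \<open>Y ^ 2 ^ r - Y\<close>.\<close>

lemma degree_le_of_dvd_frob_poly:
  fixes P :: "bit poly"
  assumes "irreducible P" "P dvd frob_poly r" "r > 0"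
  shows "degree P \<le> r"
proof -
  have prime: "prime_elem P"
    using assms(1) by (rule field_poly_irreducible_imp_prime)
  have fixed: "P dvd g ^ 2 ^ r + g" for g
  proof (induction g)
    case (pCons a g)
    have "pCons a g ^ 2 ^ r = ([:a:] + monom 1 1 * g) ^ 2 ^ r"
      by (simp add: monom_Suc)
    also have "\<dots> = [:a:] ^ 2 ^ r + monom 1 (2 ^ r) * g ^ 2 ^ r"
      by (simp add: bit_poly_power_two_power_add power_mult_distrib monom_power)
    also have "[:a:] ^ 2 ^ r = [:a:]"
      by (cases a rule: bit.exhaust) (auto simp: one_pCons[symmetric])
    finally have "pCons a g ^ 2 ^ r + pCons a g =
        ([:a:] + monom 1 (2 ^ r) * g ^ 2 ^ r) + ([:a:] + monom 1 1 * g)"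
      by (simp add: monom_Suc)
    also have "(c + Y * G) + (c + X * h) = (Y + X) * G + X * (G + h)" for c X Y G h :: "bit poly"
      by (simp add: algebra_simps)
    note this[of "[:a:]" "monom 1 (2 ^ r)" "g ^ 2 ^ r" "monom 1 1" g]
    finally show ?case
      using pCons.IH assms(2) by (metis dvd_add dvd_mult dvd_mult2)
  qed (simp add: power_0_left)
  have d: "degree P > 0"
    by (rule irreducible_degree_pos[OF assms(1)])
  let ?S = "{g :: bit poly. degree g < degree P}"
  \<comment> \<open>All \<open>2 ^ degree P\<close> residues are roots of this polynomial of degree \<open>2 ^ r\<close>.\<close>
  let ?Q = "monom 1 (2 ^ r) - monom 1 1 :: bit poly poly"
  have "degree ?Q = 2 ^ r"
    using one_less_power[of "2::nat" r] assms(3)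
    by (subst diff_conv_add_uminus, subst degree_add_eq_left) (auto simp: degree_monom_eq)
  moreover have "lead_coeff ?Q = 1"
    using assms(3) one_less_power[of "2::nat" r] unfolding calculation by auto
  moreover have "card ?S \<le> degree ?Q"
  proof (rule card_roots_mod_prime_le[OF prime])
    show "finite ?S"
      using card_bit_polys_below[of "degree P"] bit_polys_degree_less[OF d] by simp
    show "\<not> P dvd lead_coeff ?Q"
      using calculation prime by (simp add: prime_elem_def)
    show "P dvd poly ?Q a" for a
      using fixed[of a] by (simp add: poly_monom)
    fix a b assume ab: "a \<in> ?S" "b \<in> ?S" "P dvd a - b"
    then have "degree (a - b) < degree P"
      by (intro degree_diff_less) auto
    then show "a = b"
      using ab(3) by (metis dvd_imp_degree_le linorder_not_less right_minus_eq)
  qed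
  ultimately have "(2::nat) ^ degree P \<le> 2 ^ r"
    using card_bit_polys_below[of "degree P"] bit_polys_degree_less[OF d] by simp
  then show ?thesis
    by simp
qed

text \<open>Removing multiples of the degree \<open>d\<close> from \<open>n\<close> leaves
  \<open>frob_poly (n mod d)\<close>; unless \<open>n mod d\<close> is zero, the preceding bound
  would give \<open>d \<le> n mod d\<close>.\<close>

lemma degree_dvd_of_dvd_frob_poly:
  fixes P :: "bit poly"
  assumes "irreducible P" "P dvd frob_poly n"
  shows "degree P dvd n"
proof (rule ccontr)
  assume nd: "\<not> degree P dvd n"
  define d where "d = degree P"
  \<comment> \<open>The induction starts because \<open>frob_poly 0\<close> is the zero
    polynomial.\<close>
  have mult: "P dvd frob_poly (q * d)" for q
  proof (induction q)
    case (Suc q)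
    have "P dvd frob_poly d ^ 2 ^ (q * d)"
      using irreducible_dvd_frob_poly_degree[OF assms(1)]
      by (simp add: d_def dvd_power dvd_trans)
    then show ?case
      unfolding mult_Suc frob_poly_add using Suc by (rule dvd_add)
  qed simp
  have "frob_poly n = frob_poly (n div d * d) ^ 2 ^ (n mod d) + frob_poly (n mod d)"
    using frob_poly_add[of "n div d * d" "n mod d"] by simp
  moreover have "P dvd frob_poly (n div d * d) ^ 2 ^ (n mod d)"
    using mult by (meson dvd_power dvd_trans zero_less_numeral zero_less_power)
  ultimately have "P dvd frob_poly (n mod d)"
    using assms(2) by (metis dvd_add_right_iff)
  then have "d \<le> n mod d"
    using degree_le_of_dvd_frob_poly[OF assms(1)] nd by (auto simp: d_def mod_eq_0_iff_dvd)
  then show False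
    using irreducible_degree_pos[OF assms(1)] by (simp add: d_def flip: not_less)
qed

text \<open>Over GF(2) the only unit is 1, so distinct irreducibles are never associated and can be
  split off \<open>G\<close> one at a time.\<close>

lemma prod_irreducibles_dvd:
  fixes S :: "bit poly set"
  assumes "finite S" "\<And>P. P \<in> S \<Longrightarrow> irreducible P \<and> P dvd G"
  shows "\<Prod>S dvd G"
  using assms
proof (induction S)
  case (insert P S)
  obtain h where h: "G = \<Prod>S * h"
    using insert by (metis dvdE insertCI)
  have prime: "prime_elem P"
    using insert.prems by (intro field_poly_irreducible_imp_prime) simp
  have "\<not> P dvd \<Prod>S"
  proof
    assume "P dvd \<Prod>S"
    then obtain Q where "Q \<in> S" "P dvd Q"
      using prime_elem_dvd_prodD[OF prime insert.hyps(1)] by blast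
    then show False
      using bit_poly_irreducible_dvd_irreducible insert.prems insert.hyps(2) by blast
  qed
  then have "P dvd h"
    using prime insert.prems h by (metis insertI1 prime_elem_dvd_multD)
  then show ?case
    using insert.hyps h mult_dvd_mono[of P h "\<Prod>S" "\<Prod>S"] by (simp add: mult.commute)
qed simp

lemma irreducible_factor_exists:
  fixes g :: "'a :: field poly"
  assumes "degree g > 0"
  shows "\<exists>P. irreducible P \<and> P dvd g"
  using assms
proof (induction "degree g" arbitrary: g rule: less_induct)
  case less
  show ?case
  proof (cases "irreducible g")
    case False
    have "g \<noteq> 0" "\<not> is_unit g"
      using less.prems dvd_imp_degree_le[of g 1] by auto
    with False obtain a b where ab: "g = a * b" "\<not> is_unit a" "\<not> is_unit b"
      by (auto simp: irreducible_def)
    then have nz: "a \<noteq> 0" "b \<noteq> 0"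
      using \<open>g \<noteq> 0\<close> by auto
    then have "degree a > 0" "degree b > 0" "degree g = degree a + degree b"
      using ab by (auto simp: is_unit_iff_degree degree_mult_eq)
    then show ?thesis
      using less.hyps[of a] ab(1) by (metis dvd_mult2 less_add_same_cancel1)
  qed auto
qed

text \<open>The derivative of \<open>frob_poly n\<close> is 1, so no irreducible factor is repeated.
  A nonconstant cofactor \<open>u\<close> would have an irreducible factor that already occurs in
  \<open>\<Prod>S\<close>.\<close>

lemma frob_poly_dvd_prod_irreducibles:
  assumes "n > 0" "finite S" "S = {P. irreducible P \<and> P dvd frob_poly n}"
  shows "frob_poly n dvd \<Prod>S"
proof -
  have nz: "frob_poly n \<noteq> 0"
    using degree_frob_poly[OF assms(1)] by (metis degree_0 power_not_zero zero_neq_numeral)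
  obtain u where u: "frob_poly n = \<Prod>S * u"
    using prod_irreducibles_dvd[OF assms(2), of "frob_poly n"] assms(3) by blast
  have "degree u = 0"
  proof (rule ccontr)
    assume "degree u \<noteq> 0"
    then obtain Q where Q: "irreducible Q" "Q dvd u"
      using irreducible_factor_exists by blast
    then have "Q \<in> S"
      unfolding assms(3) using u by (metis (mono_tags, lifting) dvd_mult mem_Collect_eq)
    then have "Q dvd \<Prod>S"
      using assms(2) by (rule dvd_prodI[rotated])
    then obtain v where "frob_poly n = (Q * Q) * v"
      using u Q(2) by (metis dvdE mult.assoc mult_dvd_mono)
    then have "pderiv (frob_poly n) = Q * (pderiv Q * v + pderiv Q * v + Q * pderiv v)"
      by (simp add: pderiv_mult algebra_simps)
    moreover have "pderiv (frob_poly n) = 1"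
      using assms(1) by (simp add: pderiv_add pderiv_monom)
    ultimately have "is_unit Q"
      by (metis dvd_triv_left)
    then show False
      using Q(1) irreducible_not_unit by blast
  qed
  moreover have "u \<noteq> 0"
    using u nz by auto
  ultimately have "u = 1"
    by (metis bit_poly_is_unit_iff is_unit_iff_degree)
  then show ?thesis
    using u by simp
qed

section \<open>Number of irreducible polynomials of given degree\<close>

definition irreducibles :: "nat \<Rightarrow> bit poly set" where
  "irreducibles n = {P. irreducible P \<and> degree P = n}"

lemma finite_irreducibles: "finite (irreducibles n)"
proof (rule finite_subset)
  show "irreducibles n \<subseteq> {g. \<forall>i\<ge>Suc n. coeff g i = 0}"
    by (auto simp: irreducibles_def coeff_eq_0)
qed (use card_bit_polys_below in blast)

lemma degree_prod_irreducibles: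
  fixes S :: "bit poly set"
  assumes "\<And>P. P \<in> S \<Longrightarrow> irreducible P"
  shows "degree (\<Prod>S) = sum degree S"
  by (rule degree_prod_eq_sum_degree) (use assms irreducible_def in blast)

text \<open>The product of these divisors divides \<open>G\<close>; compare degrees.\<close>

lemma card_irreducible_divisors_le:
  fixes G :: "bit poly"
  assumes "G \<noteq> 0"
  shows "n * card {P \<in> irreducibles n. P dvd G} \<le> degree G"
proof -
  let ?S = "{P \<in> irreducibles n. P dvd G}"
  have "\<Prod>?S dvd G"
    by (rule prod_irreducibles_dvd) (auto intro: finite_subset[OF _ finite_irreducibles[of n]] simp: irreducibles_def)
  then have "degree (\<Prod>?S) \<le> degree G"
    using assms by (rule dvd_imp_degree_le)
  also have "degree (\<Prod>?S) = sum degree ?S"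
    by (rule degree_prod_irreducibles) (auto simp: irreducibles_def)
  also have "\<dots> = n * card ?S"
    by (simp add: irreducibles_def)
  finally show ?thesis .
qed

text \<open>The case \<open>G = frob_poly n\<close>; in the lower bound it controls the contribution
  of smaller degrees.\<close>

lemma card_irreducibles_upper:
  assumes "n > 0"
  shows "n * card (irreducibles n) \<le> 2 ^ n"
proof -
  have "{P \<in> irreducibles n. P dvd frob_poly n} = irreducibles n"
    using irreducible_dvd_frob_poly_degree by (auto simp: irreducibles_def)
  moreover have "frob_poly n \<noteq> 0"
    using degree_frob_poly[OF assms] by (metis degree_0 power_not_zero zero_neq_numeral)
  ultimately show ?thesis
    using card_irreducible_divisors_le[of "frob_poly n" n] degree_frob_poly[OF assms] by simp
qed

text \<open>The irreducible factors of \<open>frob_poly n\<close> have total degree at least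
  \<open>2 ^ n\<close>. Those of degree \<open>d\<close> other than \<open>n\<close> satisfy
  \<open>d \<le> n div 2\<close> and contribute at most \<open>2 ^ d\<close> for each
  \<open>d\<close>, altogether at most half of \<open>2 ^ n\<close>.\<close>

lemma card_irreducibles_lower:
  assumes "n > 0"
  shows "2 ^ (n - 1) \<le> n * card (irreducibles n)"
proof -
  define S where "S = {P. irreducible P \<and> P dvd frob_poly n}"
  have nz: "frob_poly n \<noteq> 0"
    using degree_frob_poly[OF assms] by (metis degree_0 power_not_zero zero_neq_numeral)
  let ?J = "insert n {1..n div 2}"
  have sub: "S \<subseteq> (\<Union>d\<in>?J. irreducibles d)"
  proof
    fix P assume "P \<in> S"
    then have P: "irreducible P" "degree P dvd n" "degree P > 0"
      using degree_dvd_of_dvd_frob_poly irreducible_degree_pos by (auto simp: S_def)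
    from P(2) obtain k where k: "n = degree P * k"
      by blast
    have "degree P = n \<or> degree P \<le> n div 2"
    proof (cases "k \<le> 1")
      case True
      then show ?thesis using k assms by (cases k) auto
    next
      case False
      then have "degree P * 2 \<le> n"
        using k by simp
      then show ?thesis by presburger
    qed
    then show "P \<in> (\<Union>d\<in>?J. irreducibles d)"
      using P by (auto simp: irreducibles_def)
  qed
  have fin: "finite (\<Union>d\<in>?J. irreducibles d)"
    by (simp add: finite_irreducibles)
  then have finS: "finite S"
    using sub finite_subset by blast
  have "frob_poly n dvd \<Prod>S"
    by (rule frob_poly_dvd_prod_irreducibles[OF assms finS S_def])
  moreover have "\<Prod>S \<noteq> 0"
    using finS by (auto simp: S_def)
  ultimately have "2 ^ n \<le> degree (\<Prod>S)"
    using degree_frob_poly[OF assms] dvd_imp_degree_le by metis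
  also have "\<dots> = sum degree S"
    by (rule degree_prod_irreducibles) (simp add: S_def)
  also have "\<dots> \<le> sum degree (\<Union>d\<in>?J. irreducibles d)"
    using fin sub by (intro sum_mono2) auto
  also have "\<dots> = (\<Sum>d\<in>?J. sum degree (irreducibles d))"
    by (rule sum.UNION_disjoint) (auto simp: finite_irreducibles, auto simp: irreducibles_def)
  also have "\<dots> = (\<Sum>d\<in>?J. d * card (irreducibles d))"
    by (rule sum.cong) (auto simp: irreducibles_def)
  also have "\<dots> = n * card (irreducibles n) + (\<Sum>d\<in>{1..n div 2}. d * card (irreducibles d))"
    using assms by (subst sum.insert) auto
  also have "(\<Sum>d\<in>{1..n div 2}. d * card (irreducibles d)) \<le> (\<Sum>d\<in>{1..n div 2}. 2 ^ d)"
    by (intro sum_mono card_irreducibles_upper) simp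
  also have "(\<Sum>d\<in>{1..n div 2}. 2 ^ d :: nat) = 2 ^ Suc (n div 2) - 2"
  proof -
    have "(\<Sum>d\<in>{1..k}. 2 ^ d :: nat) + 2 = 2 ^ Suc k" for k
      by (induction k) auto
    then show ?thesis
      by (metis add_diff_cancel_right')
  qed
  finally have main: "2 ^ n \<le> n * card (irreducibles n) + (2 ^ Suc (n div 2) - 2)"
    by simp
  \<comment> \<open>For \<open>n = 1\<close> and \<open>n = 2\<close> the subtracted 2 is essential;
    from \<open>n = 3\<close> on the exponents alone suffice.\<close>
  have "(2 :: nat) ^ Suc (n div 2) - 2 \<le> 2 ^ (n - 1)"
  proof (cases "n = 1 \<or> n = 3")
    case False
    then have "Suc (n div 2) \<le> n - 1 \<or> n = 2"
      using assms by presburger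
    then show ?thesis
    proof
      assume "Suc (n div 2) \<le> n - 1"
      then have "(2 :: nat) ^ Suc (n div 2) \<le> 2 ^ (n - 1)"
        by (rule power_increasing) simp
      then show ?thesis by simp
    qed simp
  qed auto
  moreover have "(2 :: nat) ^ n = 2 ^ (n - 1) + 2 ^ (n - 1)"
    using assms by (cases n) auto
  ultimately show ?thesis
    using main by linarith
qed


subsection \<open>Polynomials acting on sequences by shifts\<close>

definition shift_act :: "'a :: comm_ring_1 poly \<Rightarrow> (nat \<Rightarrow> 'a) \<Rightarrow> nat \<Rightarrow> 'a" where
  "shift_act g u l = (\<Sum>i\<le>degree g. coeff g i * u (l + i))"

lemma shift_act_eq_sum:
  assumes "\<And>i. i \<ge> N \<Longrightarrow> coeff g i = 0"
  shows "shift_act g u l = (\<Sum>i<N. coeff g i * u (l + i))"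
  unfolding shift_act_def using assms
  by (intro sum.mono_neutral_cong) (auto simp: coeff_eq_0)

lemma shift_act_zero_right [simp]: "shift_act g (\<lambda>_. 0) l = 0"
  by (simp add: shift_act_def)

lemma shift_act_add_right:
  "shift_act g (\<lambda>l. u l + v l) l = shift_act g u l + shift_act g v l"
  by (simp add: shift_act_def algebra_simps sum.distrib)

lemma shift_act_add: "shift_act (g + h) u l = shift_act g u l + shift_act h u l"
proof -
  let ?N = "Suc (max (degree g) (degree h))"
  have "shift_act k u l = (\<Sum>i<?N. coeff k i * u (l + i))" if "k \<in> {g, h, g + h}" for k
    using that by (intro shift_act_eq_sum) (auto simp: coeff_eq_0)
  then show ?thesis
    by (simp add: algebra_simps sum.distrib)
qed

lemma shift_act_smult: "shift_act (Polynomial.smult c g) u l = c * shift_act g u l"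
proof -
  have "shift_act (Polynomial.smult c g) u l = (\<Sum>i<Suc (degree g). coeff (Polynomial.smult c g) i * u (l + i))"
    by (rule shift_act_eq_sum) (simp add: coeff_eq_0)
  then show ?thesis
    by (simp add: shift_act_def sum_distrib_left mult.assoc lessThan_Suc_atMost)
qed

lemma shift_act_pCons: "shift_act (pCons a g) u l = a * u l + shift_act g u (Suc l)"
proof -
  have "shift_act (pCons a g) u l = (\<Sum>i<Suc (Suc (degree g)). coeff (pCons a g) i * u (l + i))"
    by (rule shift_act_eq_sum) (auto simp: coeff_pCons coeff_eq_0 split: nat.splits)
  also have "\<dots> = a * u l + (\<Sum>i<Suc (degree g). coeff g i * u (Suc l + i))"
    by (subst sum.lessThan_Suc_shift) simp
  finally show ?thesis
    by (simp only: shift_act_def lessThan_Suc_atMost)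
qed

text \<open>Sequences form a module over the polynomial ring, with \<open>X\<close> acting as the
  shift; commutativity of the ring lets two actions be exchanged.\<close>

lemma shift_act_mult: "shift_act (g * h) u l = shift_act g (shift_act h u) l"
proof (induction g arbitrary: l)
  case 0
  then show ?case by (simp add: shift_act_def)
next
  case (pCons a g)
  then show ?case
    by (simp add: shift_act_add shift_act_smult shift_act_pCons)
qed

text \<open>The polynomials annihilating a sequence form an ideal; a generator of it divides \<open>P\<close>.\<close>

lemma irreducible_annihilator_dvd:
  fixes P :: "'a :: field poly"
  assumes "irreducible P" "\<And>l. shift_act P u l = 0" "\<And>l. shift_act m u l = 0" "u l\<^sub>0 \<noteq> 0"
  shows "P dvd m"
proof -
  let ?Ann = "\<lambda>g. g \<noteq> 0 \<and> (\<forall>l. shift_act g u l = 0)"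
  have "?Ann P"
    using assms(1,2) by auto
  \<comment> \<open>A nonzero annihilator of least degree is the generator, since remainders modulo
    it annihilate \<open>u\<close> as well.\<close>
  then obtain g where g: "?Ann g" "\<And>h. ?Ann h \<Longrightarrow> degree g \<le> degree h"
    using ex_has_least_nat[of ?Ann P degree] by blast
  have gen: "g dvd h" if h: "\<And>l. shift_act h u l = 0" for h
  proof -
    have "shift_act (h mod g) u l = 0" for l
    proof -
      have "shift_act h u l = shift_act (h div g * g) u l + shift_act (h mod g) u l"
        by (simp flip: shift_act_add)
      moreover have "shift_act g u = (\<lambda>_. 0)"
        using g(1) by auto
      ultimately show ?thesis
        using h by (simp add: shift_act_mult)
    qed
    then have "h mod g = 0"
      using g degree_mod_less[of g h] by (metis linorder_not_less)
    then show ?thesis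
      by (simp add: mod_eq_0_iff_dvd)
  qed
  \<comment> \<open>A nonzero constant cannot annihilate \<open>u\<close>, which is nonzero at
    \<open>l\<^sub>0\<close>.\<close>
  have "\<not> is_unit g"
  proof
    assume "is_unit g"
    then have "degree g = 0"
      using dvd_imp_degree_le[of g 1] by simp
    then obtain c where "g = [:c:]"
      by (rule degree_eq_zeroE)
    then show False
      using g(1) assms(4) by (auto simp: shift_act_def)
  qed
  then have "P dvd g"
    using gen[OF assms(2)] assms(1) by (meson irreducibleD')
  also have "g dvd m"
    by (rule gen[OF assms(3)])
  finally show ?thesis .
qed


subsection \<open>The LFSR hash family\<close>

lemma finite_carrier_vec_bit: "finite (carrier_vec n :: bits set)"
  and card_carrier_vec_bit: "card (carrier_vec n :: bits set) = 2 ^ n"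
proof -
  have "finite (carrier_vec n :: bits set) \<and> card (carrier_vec n :: bits set) = 2 ^ n"
  proof (induction n)
    case 0
    have "(carrier_vec 0 :: bits set) = {0\<^sub>v 0}"
      by auto
    then show ?case by simp
  next
    case (Suc n)
    have bit: "(UNIV :: bit set) = {0, 1}"
      by (auto intro: bit.exhaust)
    have "(carrier_vec (Suc n) :: bits set) = case_prod vCons ` (UNIV \<times> carrier_vec n)"
    proof (intro equalityI subsetI)
      fix v :: bits assume "v \<in> carrier_vec (Suc n)"
      then show "v \<in> case_prod vCons ` (UNIV \<times> carrier_vec n)"
        by (cases v) auto
    qed auto
    moreover have "inj_on (case_prod vCons) ((UNIV :: bit set) \<times> carrier_vec n)"
      by (auto simp: inj_on_def)
    ultimately show ?case
      using Suc by (simp add: card_image card_cartesian_product bit)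
  qed
  then show "finite (carrier_vec n :: bits set)" "card (carrier_vec n :: bits set) = 2 ^ n"
    by auto
qed

lemma bits_add_self: "v \<in> carrier_vec n \<Longrightarrow> v + v = (0\<^sub>v n :: bits)"
  by (intro eq_vecI) auto

lemma bits_add_add_cancel: "v \<in> carrier_vec n \<Longrightarrow> w \<in> carrier_vec n \<Longrightarrow> v + (v + w) = (w :: bits)"
  by (intro eq_vecI) (auto simp flip: add.assoc)

lemma bits_add_eq_iff:
  "u \<in> carrier_vec n \<Longrightarrow> v \<in> carrier_vec n \<Longrightarrow> w \<in> carrier_vec n \<Longrightarrow> u + v = w \<longleftrightarrow> v = u + (w :: bits)"
  using bits_add_add_cancel by auto

text \<open>Coefficients follow vector positions, unlike the reversed \<open>sub_bit\<close>:
  position \<open>k\<close> of a message multiplies column \<open>k\<close> of the Toeplitz matrix,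
  the state after \<open>k\<close> shifts.\<close>

definition vec_poly :: "bits \<Rightarrow> bit poly" where
  "vec_poly m = (\<Sum>k<dim_vec m. monom (m $ k) k)"

lemma coeff_vec_poly: "coeff (vec_poly m) k = (if k < dim_vec m then m $ k else 0)"
  by (simp add: vec_poly_def coeff_sum coeff_monom)

lemma vec_poly_add:
  "dim_vec m = dim_vec m' \<Longrightarrow> vec_poly (m + m') = vec_poly m + vec_poly m'"
  by (intro poly_eqI) (simp add: coeff_vec_poly)

lemma vec_poly_eq_0_iff: "vec_poly m = 0 \<longleftrightarrow> m = 0\<^sub>v (dim_vec m)"
  by (auto simp: poly_eq_iff coeff_vec_poly vec_eq_iff)

lemma degree_vec_poly_less: "vec_poly m \<noteq> 0 \<Longrightarrow> degree (vec_poly m) < dim_vec m"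
  using coeff_vec_poly[of m "degree (vec_poly m)"] leading_coeff_0_iff[of "vec_poly m"]
  by (auto split: if_splits)

lemma coeff_conn_poly:
  "coeff (conn_poly p) i =
     (if i < dim_vec p then sub_bit p i else if i = dim_vec p then 1 else 0)"
  by (simp add: conn_poly_def coeff_sum coeff_monom)

lemma degree_conn_poly: "degree (conn_poly p) = dim_vec p"
  by (intro antisym degree_le le_degree) (auto simp: coeff_conn_poly)

text \<open>Every polynomial of degree \<open>n\<close> over GF(2) is monic, so its \<open>n\<close>
  lower coefficients, written highest first, recover the string.\<close>

lemma bij_betw_conn_poly:
  "bij_betw conn_poly {p \<in> carrier_vec n. irreducible (conn_poly p)} (irreducibles n)"
proof (rule bij_betw_byWitness[where f' = "\<lambda>P. vec n (\<lambda>j. coeff P (n - 1 - j))"])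
  have *: "conn_poly (vec n (\<lambda>j. coeff P (n - 1 - j))) = P" if "P \<in> irreducibles n" for P
  proof (rule poly_eqI)
    fix i
    have "degree P = n" "lead_coeff P = 1"
      using that bit_poly_lead_coeff[of P] by (fastforce simp: irreducibles_def)+
    then show "coeff (conn_poly (vec n (\<lambda>j. coeff P (n - 1 - j)))) i = coeff P i"
      by (auto simp: coeff_conn_poly sub_bit_def coeff_eq_0)
  qed
  then show "\<forall>P\<in>irreducibles n. conn_poly (vec n (\<lambda>j. coeff P (n - 1 - j))) = P"
    by blast
  show "(\<lambda>P. vec n (\<lambda>j. coeff P (n - 1 - j))) ` irreducibles n
          \<subseteq> {p \<in> carrier_vec n. irreducible (conn_poly p)}"
    using * by (auto simp: irreducibles_def)
  show "conn_poly ` {p \<in> carrier_vec n. irreducible (conn_poly p)} \<subseteq> irreducibles n"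
    by (auto simp: irreducibles_def degree_conn_poly)
  show "\<forall>p\<in>{p \<in> carrier_vec n. irreducible (conn_poly p)}.
          vec n (\<lambda>j. coeff (conn_poly p) (n - 1 - j)) = p"
    by (auto simp: coeff_conn_poly sub_bit_def)
qed

text \<open>In characteristic 2 the leading term cancels against the feedback sum that it
  equals.\<close>

lemma shift_act_conn_poly_lfsr: "shift_act (conn_poly p) (lfsr_bit p s) l = 0"
proof -
  let ?n = "dim_vec p"
  have "shift_act (conn_poly p) (lfsr_bit p s) l =
          (\<Sum>i<Suc ?n. coeff (conn_poly p) i * lfsr_bit p s (l + i))"
    by (rule shift_act_eq_sum) (simp add: coeff_conn_poly)
  also have "\<dots> = (\<Sum>i<?n. sub_bit p i * lfsr_bit p s (l + i)) + lfsr_bit p s (l + ?n)"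
    by (simp add: coeff_conn_poly)
  also have "lfsr_bit p s (l + ?n) = (\<Sum>i<?n. sub_bit p i * lfsr_bit p s (l + i))"
    by (subst lfsr_bit.simps) simp
  finally show ?thesis by simp
qed

text \<open>The sequence is arbitrary because the lemma is applied to an LFSR sequence on which a
  message polynomial has acted.\<close>

lemma recurrence_eq_0:
  assumes "\<And>l. shift_act (conn_poly p) u l = 0" "\<And>l. l < dim_vec p \<Longrightarrow> u l = 0"
  shows "u l = 0"
proof (induction l rule: less_induct)
  case (less l)
  show ?case
  proof (cases "l < dim_vec p")
    case False
    let ?n = "dim_vec p"
    have "0 = shift_act (conn_poly p) u (l - ?n)"
      using assms(1) by simp
    also have "\<dots> = (\<Sum>i<Suc ?n. coeff (conn_poly p) i * u (l - ?n + i))"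
      by (rule shift_act_eq_sum) (simp add: coeff_conn_poly)
    also have "\<dots> = (\<Sum>i<?n. sub_bit p i * u (l - ?n + i)) + u l"
      using False by (simp add: coeff_conn_poly)
    also have "(\<Sum>i<?n. sub_bit p i * u (l - ?n + i)) = 0"
      using False by (intro sum.neutral) (simp add: less)
    finally show ?thesis by simp
  qed (use assms(2) in simp)
qed

lemma lfsr_bit_add:
  assumes "dim_vec s = dim_vec p" "dim_vec s' = dim_vec p"
  shows "lfsr_bit p (s + s') l = lfsr_bit p s l + lfsr_bit p s' l"
proof (induction l rule: less_induct)
  case (less l)
  show ?case
  proof (cases "l < dim_vec p")
    case True
    then show ?thesis
      using assms by (simp add: lfsr_bit.simps[of p] sub_bit_def)
  next
    case False
    have "lfsr_bit p (s + s') l =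
        (\<Sum>i<dim_vec p. sub_bit p i * lfsr_bit p (s + s') (l - dim_vec p + i))"
      using False by (subst lfsr_bit.simps) simp
    also have "\<dots> = (\<Sum>i<dim_vec p. sub_bit p i * (lfsr_bit p s (l - dim_vec p + i)
                      + lfsr_bit p s' (l - dim_vec p + i)))"
      using False by (intro sum.cong) (auto simp: less)
    also have "\<dots> = (\<Sum>i<dim_vec p. sub_bit p i * lfsr_bit p s (l - dim_vec p + i))
                      + (\<Sum>i<dim_vec p. sub_bit p i * lfsr_bit p s' (l - dim_vec p + i))"
      by (simp only: distrib_left sum.distrib)
    finally show ?thesis
      using False by (simp only: lfsr_bit.simps[of p _ l] if_False)
  qed
qed

lemma dim_axu_hash [simp]: "dim_vec (axu_hash (p, s) m) = dim_vec p"
  by (simp add: axu_hash_def toeplitz_def)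

text \<open>The position \<open>dim_vec p - 1 - j\<close> is reversed because states are written
  with the highest index first.\<close>

lemma axu_hash_index:
  assumes "j < dim_vec p"
  shows "axu_hash (p, s) m $ j = shift_act (vec_poly m) (lfsr_bit p s) (dim_vec p - 1 - j)"
proof -
  have "axu_hash (p, s) m $ j = (\<Sum>k<dim_vec m. lfsr_bit p s (dim_vec p - 1 - j + k) * m $ k)"
    using assms
    by (simp add: axu_hash_def toeplitz_def scalar_prod_def mat_of_cols_index lfsr_state_def Let_def
        lessThan_atLeast0)
  also have "\<dots> = (\<Sum>k<dim_vec m. coeff (vec_poly m) k * lfsr_bit p s (dim_vec p - 1 - j + k))"
    by (intro sum.cong) (auto simp: coeff_vec_poly mult.commute)
  also have "\<dots> = shift_act (vec_poly m) (lfsr_bit p s) (dim_vec p - 1 - j)"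
    by (rule shift_act_eq_sum[symmetric]) (simp add: coeff_vec_poly)
  finally show ?thesis .
qed

lemma axu_hash_add_message:
  "dim_vec m = dim_vec m' \<Longrightarrow> axu_hash f (m + m') = axu_hash f m + axu_hash f m'"
  by (cases f, intro eq_vecI) (auto simp: axu_hash_index vec_poly_add shift_act_add)

lemma axu_hash_add_state:
  assumes "dim_vec s = dim_vec p" "dim_vec s' = dim_vec p"
  shows "axu_hash (p, s + s') m = axu_hash (p, s) m + axu_hash (p, s') m"
proof -
  have "lfsr_bit p (s + s') = (\<lambda>l. lfsr_bit p s l + lfsr_bit p s' l)"
    using lfsr_bit_add[OF assms] by auto
  then have index: "axu_hash (p, s + s') m $ j = axu_hash (p, s) m $ j + axu_hash (p, s') m $ j"
    if "j < dim_vec p" for j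
    using that by (simp only: axu_hash_index shift_act_add_right)
  show ?thesis
  proof (rule eq_vecI)
    fix j assume "j < dim_vec (axu_hash (p, s) m + axu_hash (p, s') m)"
    then have j: "j < dim_vec p"
      by simp
    show "axu_hash (p, s + s') m $ j = (axu_hash (p, s) m + axu_hash (p, s') m) $ j"
      unfolding index[OF j] using j by (subst index_add_vec(1)) auto
  qed simp
qed

text \<open>If the hash vanishes, the sequence acted on by \<open>vec_poly m\<close> starts with
  \<open>n\<close> zeros and still obeys the recurrence, so it is zero. Then
  \<open>vec_poly m\<close> and the irreducible \<open>conn_poly p\<close> both annihilate the
  nonzero LFSR sequence. Conversely, every multiple of \<open>conn_poly p\<close> annihilates
  it.\<close>

lemma axu_hash_eq_0_iff:
  assumes "(p, s) \<in> axu_seeds n"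
  shows "axu_hash (p, s) m = 0\<^sub>v n \<longleftrightarrow> conn_poly p dvd vec_poly m"
proof
  have irr: "irreducible (conn_poly p)" and dims: "dim_vec p = n" "dim_vec s = n" "s \<noteq> 0\<^sub>v n"
    using assms by (auto simp: axu_seeds_def)
  let ?u = "shift_act (vec_poly m) (lfsr_bit p s)"
  {
    assume 0: "axu_hash (p, s) m = 0\<^sub>v n"
    have "?u l = 0" for l
    proof (rule recurrence_eq_0)
      fix l
      have "shift_act (conn_poly p) ?u l =
              shift_act (vec_poly m) (shift_act (conn_poly p) (lfsr_bit p s)) l"
        by (simp flip: shift_act_mult add: mult.commute)
      also have "shift_act (conn_poly p) (lfsr_bit p s) = (\<lambda>_. 0)"
        using shift_act_conn_poly_lfsr by auto
      finally show "shift_act (conn_poly p) ?u l = 0"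
        by simp
    next
      fix l assume l: "l < dim_vec p"
      then show "?u l = 0"
        using axu_hash_index[of "dim_vec p - 1 - l" p s m] 0 dims by simp
    qed
    moreover obtain j where "j < n" "s $ j \<noteq> 0"
      using dims by (auto simp: vec_eq_iff)
    then have "lfsr_bit p s (n - 1 - j) \<noteq> 0"
      using dims by (simp add: lfsr_bit.simps[of p] sub_bit_def)
    ultimately show "conn_poly p dvd vec_poly m"
      using irreducible_annihilator_dvd[OF irr shift_act_conn_poly_lfsr] by blast
  }
  {
    assume "conn_poly p dvd vec_poly m"
    then obtain g where "vec_poly m = g * conn_poly p"
      by (metis dvdE mult.commute)
    moreover have "shift_act (conn_poly p) (lfsr_bit p s) = (\<lambda>_. 0)"
      using shift_act_conn_poly_lfsr by auto
    ultimately show "axu_hash (p, s) m = 0\<^sub>v n"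
      using dims by (intro eq_vecI) (auto simp: axu_hash_index shift_act_mult)
  }
qed

section \<open>Counting seeds and collisions\<close>

lemma axu_seeds_eq_Times:
  "axu_seeds n = {p \<in> carrier_vec n. irreducible (conn_poly p)} \<times> (carrier_vec n - {0\<^sub>v n})"
  by (auto simp: axu_seeds_def)

lemma finite_axu_seeds: "finite (axu_seeds n)"
  unfolding axu_seeds_eq_Times using finite_carrier_vec_bit by simp

lemma card_axu_seeds: "card (axu_seeds n) = card (irreducibles n) * (2 ^ n - 1)"
  unfolding axu_seeds_eq_Times
  using bij_betw_same_card[OF bij_betw_conn_poly[of n]] finite_carrier_vec_bit[of n]
  by (simp add: card_cartesian_product card_Diff_singleton card_carrier_vec_bit)

lemma axu_seeds_nonempty:
  assumes "n \<ge> 1"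
  shows "axu_seeds n \<noteq> {}"
proof -
  have "card (irreducibles n) > 0"
    using card_irreducibles_lower[of n] assms by (cases "card (irreducibles n)") auto
  moreover have "(2 :: nat) ^ n > 1"
    using assms by (intro one_less_power) auto
  ultimately have "card (axu_seeds n) > 0"
    by (simp add: card_axu_seeds)
  then show ?thesis by auto
qed

text \<open>The bound \<open>L / 2 ^ (n - 1)\<close> on a probability, with denominators cleared.
  For \<open>b = 0\<close> the polynomials dividing \<open>vec_poly m\<close> count, each with all
  nonzero states; for any other \<open>b\<close> each polynomial admits at most one state.\<close>

lemma card_axu_seeds_hash_eq_le:
  assumes "n \<ge> 1" "m \<in> carrier_vec L" "m \<noteq> 0\<^sub>v L"
  shows "card {f \<in> axu_seeds n. axu_hash f m = b} * 2 ^ (n - 1) \<le> L * card (axu_seeds n)"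
proof -
  let ?I = "{p \<in> carrier_vec n. irreducible (conn_poly p)}"
  let ?H = "{f \<in> axu_seeds n. axu_hash f m = b}"
  have dim: "dim_vec m = L" and nz: "vec_poly m \<noteq> 0"
    using assms(2,3) by (auto simp: vec_poly_eq_0_iff)
  have L: "degree (vec_poly m) < L"
    using degree_vec_poly_less[OF nz] dim by simp
  have cardI: "card ?I = card (irreducibles n)"
    by (rule bij_betw_same_card[OF bij_betw_conn_poly])
  have finI: "finite ?I"
    using finite_carrier_vec_bit by simp
  have le: "(2 :: nat) ^ (n - 1) \<le> 2 ^ n - 1"
    using assms(1) by (cases n) auto
  show ?thesis
  proof (cases "b = 0\<^sub>v n")
    case True
    let ?D = "{p \<in> ?I. conn_poly p dvd vec_poly m}"
    have "?H = ?D \<times> (carrier_vec n - {0\<^sub>v n})"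
    proof (intro equalityI subsetI)
      fix f :: seed assume "f \<in> ?H"
      then show "f \<in> ?D \<times> (carrier_vec n - {0\<^sub>v n})"
        using True axu_hash_eq_0_iff[of "fst f" "snd f" n m]
        by (simp add: axu_seeds_eq_Times mem_Times_iff)
    next
      fix f :: seed assume "f \<in> ?D \<times> (carrier_vec n - {0\<^sub>v n})"
      then show "f \<in> ?H"
        using True axu_hash_eq_0_iff[of "fst f" "snd f" n m]
        by (simp add: axu_seeds_eq_Times mem_Times_iff)
    qed
    then have H: "card ?H = card ?D * (2 ^ n - 1)"
      using finite_carrier_vec_bit[of n]
      by (simp add: card_cartesian_product card_Diff_singleton card_carrier_vec_bit)
    have "card ?D = card {P \<in> irreducibles n. P dvd vec_poly m}"
    proof (rule bij_betw_same_card)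
      show "bij_betw conn_poly ?D {P \<in> irreducibles n. P dvd vec_poly m}"
        using bij_betw_conn_poly[of n] unfolding bij_betw_def by (auto simp: inj_on_def)
    qed
    then have "n * card ?D \<le> L"
      using card_irreducible_divisors_le[OF nz, of n] L by simp
    \<comment> \<open>The factor \<open>n\<close> lost in the lower bound on irreducibles is
      regained from the bound on \<open>n * card ?D\<close>.\<close>
    have "card ?D * 2 ^ (n - 1) \<le> card ?D * (n * card (irreducibles n))"
      using card_irreducibles_lower[of n] assms(1) by (intro mult_left_mono) auto
    also have "\<dots> = (n * card ?D) * card (irreducibles n)"
      by simp
    also have "\<dots> \<le> L * card (irreducibles n)"
      using \<open>n * card ?D \<le> L\<close> by (rule mult_right_mono) simp
    finally have "card ?D * 2 ^ (n - 1) * (2 ^ n - 1) \<le> L * card (irreducibles n) * (2 ^ n - 1)"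
      by (rule mult_right_mono) simp
    then show ?thesis
      unfolding H card_axu_seeds by (simp only: mult_ac)
  next
    case False
    \<comment> \<open>Two states with equal hash have a sum with hash zero. If the sum is nonzero,
      \<open>conn_poly p\<close> divides \<open>vec_poly m\<close>, so the hash is zero for every
      nonzero state, against \<open>b \<noteq> 0\<^sub>v n\<close>.\<close>
    have "inj_on fst ?H"
    proof (rule inj_onI, clarsimp)
      fix p s s' assume f: "(p, s) \<in> axu_seeds n" "(p, s') \<in> axu_seeds n"
        and b: "axu_hash (p, s') m = axu_hash (p, s) m" "b = axu_hash (p, s) m"
      have dims: "p \<in> carrier_vec n" "s \<in> carrier_vec n" "s' \<in> carrier_vec n"
        using f by (auto simp: axu_seeds_def)
      have hc: "axu_hash (p, s) m \<in> carrier_vec n"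
        using dims by (intro carrier_vecI) simp
      show "s = s'"
      proof (rule ccontr)
        assume "s \<noteq> s'"
        then have "s + s' \<noteq> 0\<^sub>v n"
          using dims bits_add_eq_iff[of s n s' "0\<^sub>v n"] by auto
        then have "(p, s + s') \<in> axu_seeds n"
          using f by (auto simp: axu_seeds_def)
        moreover have "axu_hash (p, s + s') m = 0\<^sub>v n"
          using dims b axu_hash_add_state[of s p s' m] bits_add_self[OF hc] by simp
        ultimately have "axu_hash (p, s) m = 0\<^sub>v n"
          using axu_hash_eq_0_iff f(1) by blast
        then show False
          using b False by simp
      qed
    qed
    moreover have "fst ` ?H \<subseteq> ?I"
      by (auto simp: axu_seeds_def)
    ultimately have "card ?H \<le> card ?I"
      using finI by (rule card_inj_on_le)
    then have "card ?H * 2 ^ (n - 1) \<le> card (irreducibles n) * (2 ^ n - 1)"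
      unfolding cardI using le by (rule mult_le_mono)
    \<comment> \<open>\<open>L\<close> is at least 1, because the degree of
      \<open>vec_poly m\<close> is strictly below it.\<close>
    also have "\<dots> \<le> L * card (axu_seeds n)"
      using L by (simp add: card_axu_seeds)
    finally show ?thesis .
  qed
qed


subsection \<open>Authentication with a recycled hash function\<close>

lemma prob_bind_pmf_le:
  assumes "\<And>x. x \<in> set_pmf M \<Longrightarrow> measure_pmf.prob (f x) S \<le> c" "0 \<le> c"
  shows "measure_pmf.prob (bind_pmf M f) S \<le> c"
proof -
  have "emeasure (measure_pmf (bind_pmf M f)) S = (\<integral>\<^sup>+x. emeasure (f x) S \<partial>M)"
    by simp
  also have "\<dots> \<le> (\<integral>\<^sup>+x. ennreal c \<partial>M)"
    using assms
    by (intro nn_integral_mono_AE) (auto simp: AE_measure_pmf_iff measure_pmf.emeasure_eq_measure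
        intro: ennreal_leI)
  also have "\<dots> = ennreal c"
    by simp
  finally show ?thesis
    using assms(2) by (simp add: measure_pmf.emeasure_eq_measure)
qed

text \<open>On \<open>T\<close> the continuation is bounded trivially by 1; \<open>T\<close> will be
  the event of an accepted forgery.\<close>

lemma prob_bind_pmf_le_prob:
  assumes "\<And>x. x \<in> set_pmf M \<Longrightarrow> x \<notin> T \<Longrightarrow> measure_pmf.prob (f x) S = 0"
  shows "measure_pmf.prob (bind_pmf M f) S \<le> measure_pmf.prob M T"
proof -
  have "emeasure (measure_pmf (bind_pmf M f)) S = (\<integral>\<^sup>+x. emeasure (f x) S \<partial>M)"
    by simp
  also have "\<dots> \<le> (\<integral>\<^sup>+x. indicator T x \<partial>M)"
    using assms
    by (intro nn_integral_mono_AE) (auto simp: AE_measure_pmf_iff measure_pmf.emeasure_eq_measure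
        indicator_def)
  also have "\<dots> = emeasure M T"
    by simp
  finally show ?thesis
    by (simp add: measure_pmf.emeasure_eq_measure)
qed

lemma set_pmf_uniform_bits [simp]: "set_pmf (uniform_bits n) = carrier_vec n"
  unfolding uniform_bits_def
  by (rule set_pmf_of_set) (auto simp: finite_carrier_vec_bit intro: zero_carrier_vec)

lemma set_pmf_axu_seeds: "n \<ge> 1 \<Longrightarrow> set_pmf (pmf_of_set (axu_seeds n)) = axu_seeds n"
  by (intro set_pmf_of_set axu_seeds_nonempty finite_axu_seeds)

lemma axu_hash_carrier: "f \<in> axu_seeds n \<Longrightarrow> axu_hash f m \<in> carrier_vec n"
  by (cases f) (auto simp: axu_seeds_def intro: carrier_vecI)

text \<open>The one-time pad: XOR with a fixed string is an involution.\<close>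

lemma map_uniform_bits_add:
  assumes "h \<in> carrier_vec n"
  shows "map_pmf (\<lambda>k. h + k) (uniform_bits n) = uniform_bits n"
  unfolding uniform_bits_def
proof (rule map_pmf_of_set_bij_betw)
  show "bij_betw (\<lambda>k. h + k) (carrier_vec n) (carrier_vec n)"
    by (rule bij_betw_byWitness[where f' = "\<lambda>k. h + k"])
      (use assms in \<open>auto simp: bits_add_add_cancel\<close>)
qed (auto simp: finite_carrier_vec_bit intro: zero_carrier_vec)

text \<open>With the pad expressed through the observed tag \<open>t\<close>, acceptance forces the
  nonzero difference \<open>m + m'\<close> to hash to \<open>t + t'\<close>, by linearity in the
  message. The slack up to \<open>N\<close> lets one bound serve messages of different
  lengths.\<close>

lemma prob_forgery_le:
  assumes "n \<ge> 1" "m \<in> carrier_vec L" "m' \<in> carrier_vec L" "m \<noteq> m'" "L \<le> N" "t \<in> carrier_vec n"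
  shows "measure_pmf.prob (pmf_of_set (axu_seeds n)) {f. authentic f (axu_hash f m + t) L (m', t')}
           \<le> real N / 2 ^ (n - 1)"
proof -
  let ?H = "{f \<in> axu_seeds n. axu_hash f (m + m') = t + t'}"
  have "axu_seeds n \<inter> {f. authentic f (axu_hash f m + t) L (m', t')} \<subseteq> ?H"
  proof
    fix f assume f: "f \<in> axu_seeds n \<inter> {f. authentic f (axu_hash f m + t) L (m', t')}"
    then have h: "axu_hash f m \<in> carrier_vec n" "axu_hash f m' \<in> carrier_vec n"
      using axu_hash_carrier by auto
    have "t' = axu_hash f m' + (axu_hash f m + t)"
      using f by (simp add: authentic_def)
    also have "\<dots> = t + (axu_hash f m + axu_hash f m')"
      using h assms(6)
      by (simp add: comm_add_vec[of "axu_hash f m'" n] comm_add_vec[of _ n t] assoc_add_vec[of t n])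
    finally have "t + t' = axu_hash f m + axu_hash f m'"
      using h assms(6) by (simp add: bits_add_add_cancel)
    then show "f \<in> ?H"
      using f assms(2,3) axu_hash_add_message[of m m' f] by simp
  qed
  then have "card (axu_seeds n \<inter> {f. authentic f (axu_hash f m + t) L (m', t')}) \<le> card ?H"
    by (intro card_mono) (simp_all add: finite_axu_seeds)
  then have "card (axu_seeds n \<inter> {f. authentic f (axu_hash f m + t) L (m', t')}) * 2 ^ (n - 1)
               \<le> card ?H * 2 ^ (n - 1)"
    by (rule mult_right_mono) simp
  also have "\<dots> \<le> L * card (axu_seeds n)"
    using assms bits_add_eq_iff[of m L m' "0\<^sub>v L"]
    by (intro card_axu_seeds_hash_eq_le) auto
  also have "\<dots> \<le> N * card (axu_seeds n)"
    using assms(5) by simp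
  finally have "real (card (axu_seeds n \<inter> {f. authentic f (axu_hash f m + t) L (m', t')})) * 2 ^ (n - 1)
               \<le> real N * real (card (axu_seeds n))"
    unfolding of_nat_le_iff[where 'a = real, symmetric] by simp
  moreover have "real (card (axu_seeds n)) > 0"
    using axu_seeds_nonempty[OF assms(1)] finite_axu_seeds by (simp add: card_gt_0_iff)
  ultimately show ?thesis
    unfolding measure_pmf_of_set[OF axu_seeds_nonempty[OF assms(1)] finite_axu_seeds]
    by (simp only: pos_divide_le_eq pos_le_divide_eq times_divide_eq_left zero_less_power
        zero_less_numeral)
qed

text \<open>
  With a fixed tag \<open>t\<close> the pad is \<open>axu_hash f m + t\<close>, and the attacker's view does not depend on the
  still uniform seed \<open>f\<close>. Either the packet is delivered unchanged, which reveals nothing about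
  \<open>f\<close>, or everything after this delivery is bounded by the probability of a forgery. Hence the
  bounds for successive messages do not add up.
\<close>

lemma prob_delivery_le:
  fixes R :: "seed \<Rightarrow> packet \<Rightarrow> 'st \<Rightarrow> outcome pmf"
  assumes "n \<ge> 1" "m \<in> carrier_vec L" "L \<le> N" "t \<in> carrier_vec n" "Aborted \<notin> W"
    and honest: "\<And>st. measure_pmf.prob (bind_pmf (pmf_of_set (axu_seeds n)) (\<lambda>f. R f (m, t) st)) W
                   \<le> real N / 2 ^ (n - 1)"
  shows "measure_pmf.prob (bind_pmf (pmf_of_set (axu_seeds n)) (\<lambda>f. bind_pmf D (\<lambda>(d, st).
            if \<not> authentic f (axu_hash f m + t) L d then return_pmf Aborted else R f d st))) W
           \<le> real N / 2 ^ (n - 1)"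
\<comment> \<open>The distribution \<open>D\<close> does not depend on \<open>f\<close>, so the
  delivered packet can be fixed before the seed is drawn.\<close>
proof (subst bind_commute_pmf, rule prob_bind_pmf_le)
  fix x :: "packet \<times> 'st"
  obtain m' t' st where x: "x = ((m', t'), st)"
    by (metis surj_pair)
  let ?F = "pmf_of_set (axu_seeds n)"
  let ?G = "\<lambda>f. if \<not> authentic f (axu_hash f m + t) L (m', t') then return_pmf Aborted
                 else R f (m', t') st"
  have seeds: "set_pmf ?F = axu_seeds n"
    by (rule set_pmf_axu_seeds[OF assms(1)])
  have "measure_pmf.prob (bind_pmf ?F ?G) W \<le> real N / 2 ^ (n - 1)"
  proof (cases "m' = m")
    case True
    \<comment> \<open>For the original message the two hashes cancel, so acceptance carries no
      information about \<open>f\<close>.\<close>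
    have auth: "authentic f (axu_hash f m + t) L (m', t') \<longleftrightarrow> t' = t" if "f \<in> axu_seeds n" for f
      using True assms(2,4) axu_hash_carrier[OF that]
      by (auto simp: authentic_def bits_add_add_cancel)
    show ?thesis
    proof (cases "t' = t")
      case True
      have "bind_pmf ?F ?G = bind_pmf ?F (\<lambda>f. R f (m, t) st)"
        by (rule bind_pmf_cong) (use True \<open>m' = m\<close> auth seeds in auto)
      then show ?thesis
        using honest by simp
    next
      case False
      show ?thesis
        by (rule prob_bind_pmf_le) (use False auth seeds assms(5) in \<open>auto simp: measure_return_pmf\<close>)
    qed
  next
    case False
    show ?thesis
    proof (cases "m' \<in> carrier_vec L")
      case True
      have "measure_pmf.prob (bind_pmf ?F ?G) W
              \<le> measure_pmf.prob ?F {f. authentic f (axu_hash f m + t) L (m', t')}"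
        by (rule prob_bind_pmf_le_prob) (use assms(5) in \<open>auto simp: measure_return_pmf\<close>)
      also have "\<dots> \<le> real N / 2 ^ (n - 1)"
        using False by (intro prob_forgery_le[OF assms(1,2) True _ assms(3,4)]) simp
      finally show ?thesis .
    next
      case False
      then have "\<not> authentic f (axu_hash f m + t) L (m', t')" for f
        by (simp add: authentic_def)
      then show ?thesis
        using assms(5) by (intro prob_bind_pmf_le) (auto simp: measure_return_pmf)
    qed
  qed
  then show "measure_pmf.prob (bind_pmf ?F (\<lambda>f. case x of (d, st) \<Rightarrow>
            if \<not> authentic f (axu_hash f m + t) L d then return_pmf Aborted else R f d st)) W
           \<le> real N / 2 ^ (n - 1)"
    unfolding x prod.case .
qed simp


subsection \<open>The repudiation attack\<close>

text \<open>The run once keys, seed, pads and signature are fixed, isolated so that these draws can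
  be reordered in front of it.\<close>

definition channel_run ::
  "nat \<Rightarrow> nat \<Rightarrow> 'st adversary \<Rightarrow> bits \<Rightarrow> bits \<Rightarrow> bits \<Rightarrow> bits \<Rightarrow> 'st \<Rightarrow>
     seed \<Rightarrow> bits \<Rightarrow> bits \<Rightarrow> bits \<Rightarrow> bits \<Rightarrow> outcome pmf" where
  "channel_run bM bH A X\<^sub>B X\<^sub>C doc sig st\<^sub>0 f k\<^sub>1 k\<^sub>2 k\<^sub>3 k\<^sub>4 =
     bind_pmf (adv_pair A st\<^sub>0 (auth_packet f k\<^sub>1 (doc @\<^sub>v sig)) (auth_packet f k\<^sub>2 X\<^sub>B)) (\<lambda>(d\<^sub>1, st\<^sub>1).
     if \<not> authentic f k\<^sub>1 (bM + 2 * bH) d\<^sub>1 then return_pmf Aborted else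
     bind_pmf (adv_key_B A st\<^sub>1) (\<lambda>(d\<^sub>2, st\<^sub>2).
     if \<not> authentic f k\<^sub>2 (3 * bH) d\<^sub>2 then return_pmf Aborted else
     bind_pmf (adv_key_C A st\<^sub>2 (auth_packet f k\<^sub>3 X\<^sub>C)) (\<lambda>(d\<^sub>3, st\<^sub>3).
     if \<not> authentic f k\<^sub>3 (3 * bH) d\<^sub>3 then return_pmf Aborted else
     let bob = accepts bM bH (X\<^sub>B + fst d\<^sub>3) doc sig in
     bind_pmf (adv_outcome A st\<^sub>3 (auth_packet f k\<^sub>4 (vec 1 (\<lambda>_. of_bool bob)))) (\<lambda>d\<^sub>4.
     if \<not> authentic f k\<^sub>4 1 d\<^sub>4 then return_pmf Aborted else
     return_pmf (Completed bob (accepts bM bH (X\<^sub>C + fst d\<^sub>2)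
       (vec_first (fst d\<^sub>1) bM) (vec_last (fst d\<^sub>1) (2 * bH))))))))"

lemma protocol_run_eq:
  "protocol_run bM bH n A =
     bind_pmf (uniform_bits (3 * bH)) (\<lambda>X\<^sub>B. bind_pmf (uniform_bits (3 * bH)) (\<lambda>X\<^sub>C.
     bind_pmf (pmf_of_set (axu_seeds n)) (\<lambda>f.
     bind_pmf (uniform_bits n) (\<lambda>k\<^sub>1. bind_pmf (uniform_bits n) (\<lambda>k\<^sub>2.
     bind_pmf (uniform_bits n) (\<lambda>k\<^sub>3. bind_pmf (uniform_bits n) (\<lambda>k\<^sub>4.
     bind_pmf (adv_sign A (X\<^sub>B + X\<^sub>C)) (\<lambda>(doc, sig, st\<^sub>0).
     channel_run bM bH A X\<^sub>B X\<^sub>C doc sig st\<^sub>0 f k\<^sub>1 k\<^sub>2 k\<^sub>3 k\<^sub>4))))))))"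
  unfolding protocol_run_def channel_run_def Let_def ..

text \<open>For a given seed, replacing a pad by \<open>axu_hash f m + t\<close> preserves
  uniformity; the tags are then independent of the seed, which can be drawn last. The fourth pad
  stays as it is, because its message, Bob's verdict, is only determined during the run.\<close>

lemma pads_to_tags:
  assumes "n \<ge> 1"
  shows "bind_pmf (pmf_of_set (axu_seeds n)) (\<lambda>f.
           bind_pmf (uniform_bits n) (\<lambda>k\<^sub>1. bind_pmf (uniform_bits n) (\<lambda>k\<^sub>2.
           bind_pmf (uniform_bits n) (\<lambda>k\<^sub>3. bind_pmf (uniform_bits n) (\<lambda>k\<^sub>4. G f k\<^sub>1 k\<^sub>2 k\<^sub>3 k\<^sub>4)))))
         = bind_pmf (uniform_bits n) (\<lambda>t\<^sub>1. bind_pmf (uniform_bits n) (\<lambda>t\<^sub>2.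
           bind_pmf (uniform_bits n) (\<lambda>t\<^sub>3. bind_pmf (uniform_bits n) (\<lambda>k\<^sub>4.
           bind_pmf (pmf_of_set (axu_seeds n)) (\<lambda>f.
             G f (axu_hash f m\<^sub>1 + t\<^sub>1) (axu_hash f m\<^sub>2 + t\<^sub>2) (axu_hash f m\<^sub>3 + t\<^sub>3) k\<^sub>4)))))"
    (is "?lhs = ?rhs")
proof -
  let ?F = "pmf_of_set (axu_seeds n)" and ?U = "uniform_bits n"
  have pad: "bind_pmf ?U H = bind_pmf ?U (\<lambda>t. H (axu_hash f m + t))"
    if "f \<in> set_pmf ?F" for f m and H :: "bits \<Rightarrow> 'a pmf"
  proof -
    have "bind_pmf ?U H = bind_pmf (map_pmf (\<lambda>k. axu_hash f m + k) ?U) H"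
      using that axu_hash_carrier[of f n m]
      by (simp add: map_uniform_bits_add set_pmf_axu_seeds[OF assms])
    then show ?thesis
      by (simp add: bind_map_pmf)
  qed
  have "?lhs = bind_pmf ?F (\<lambda>f. bind_pmf ?U (\<lambda>t\<^sub>1. bind_pmf ?U (\<lambda>t\<^sub>2. bind_pmf ?U (\<lambda>t\<^sub>3.
          bind_pmf ?U (\<lambda>k\<^sub>4. G f (axu_hash f m\<^sub>1 + t\<^sub>1) (axu_hash f m\<^sub>2 + t\<^sub>2) (axu_hash f m\<^sub>3 + t\<^sub>3) k\<^sub>4)))))"
    by (rule bind_pmf_cong[OF refl], subst pad[of _ _ m\<^sub>1], assumption,
        rule bind_pmf_cong[OF refl], subst pad[of _ _ m\<^sub>2], assumption,
        rule bind_pmf_cong[OF refl], subst pad[of _ _ m\<^sub>3], assumption, rule refl)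
  also have "\<dots> = ?rhs"
    unfolding bind_commute_pmf[of ?F ?U] ..
  finally show ?thesis .
qed

definition repudiation :: "outcome set" where
  "repudiation = {r. r \<noteq> Aborted \<and> bob_accepts r \<and> \<not> charlie_accepts r}"

lemma Aborted_notin_repudiation [simp]: "Aborted \<notin> repudiation"
  by (simp add: repudiation_def)

lemma Completed_in_repudiation [simp]: "Completed b c \<in> repudiation \<longleftrightarrow> b \<and> \<not> c"
  by (simp add: repudiation_def)

lemma auth_packet_tag:
  "f \<in> axu_seeds n \<Longrightarrow> t \<in> carrier_vec n \<Longrightarrow> auth_packet f (axu_hash f m + t) m = (m, t)"
  by (simp add: auth_packet_def bits_add_add_cancel[OF axu_hash_carrier])

text \<open>The delivery bound is nested over the pair, \<open>X\<^sub>B\<close> and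
  \<open>X\<^sub>C\<close>. What remains is a run with all three intact, where both verdicts agree
  because key addition commutes, whatever happens to the outcome message.\<close>

lemma prob_channel_run_le:
  assumes n: "n \<ge> 1" and bM: "bM > bH"
    and X: "X\<^sub>B \<in> carrier_vec (3 * bH)" "X\<^sub>C \<in> carrier_vec (3 * bH)"
    and t: "t\<^sub>1 \<in> carrier_vec n" "t\<^sub>2 \<in> carrier_vec n" "t\<^sub>3 \<in> carrier_vec n"
  shows "measure_pmf.prob (bind_pmf (pmf_of_set (axu_seeds n)) (\<lambda>f.
            channel_run bM bH A X\<^sub>B X\<^sub>C doc sig st\<^sub>0 f (axu_hash f (doc @\<^sub>v sig) + t\<^sub>1)
              (axu_hash f X\<^sub>B + t\<^sub>2) (axu_hash f X\<^sub>C + t\<^sub>3) k\<^sub>4)) repudiation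
           \<le> real (2 * bH + bM) / 2 ^ (n - 1)" (is "measure_pmf.prob ?run _ \<le> ?\<epsilon>")
\<comment> \<open>With wrong lengths Bob rejects; with correct lengths the concatenation splits back
  into \<open>doc\<close> and \<open>sig\<close>.\<close>
proof (cases "doc \<in> carrier_vec bM \<and> sig \<in> carrier_vec (2 * bH)")
  case False
  then have "\<not> accepts bM bH K doc sig" for K
    by (auto simp: accepts_def)
  then have "set_pmf ?run \<inter> repudiation = {}"
    by (auto simp: channel_run_def Let_def split: if_splits)
  then have "measure_pmf.prob ?run repudiation = 0"
    by (simp add: measure_pmf_zero_iff)
  then show ?thesis by simp
next
  case True
  let ?F = "pmf_of_set (axu_seeds n)"
  define m where "m = doc @\<^sub>v sig"
  have m: "m \<in> carrier_vec (bM + 2 * bH)"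
    using True by (simp add: m_def)
  have parts: "vec_first m bM = doc" "vec_last m (2 * bH) = sig"
    using True by (auto simp: m_def vec_first_def vec_last_def)
  \<comment> \<open>Once sent packets show tags instead of pads, the attacker's first three moves no
    longer mention \<open>f\<close>, as \<open>prob_delivery_le\<close> requires.\<close>
  have "?run = bind_pmf ?F (\<lambda>f. bind_pmf (adv_pair A st\<^sub>0 (m, t\<^sub>1) (X\<^sub>B, t\<^sub>2)) (\<lambda>(d\<^sub>1, st\<^sub>1).
     if \<not> authentic f (axu_hash f m + t\<^sub>1) (bM + 2 * bH) d\<^sub>1 then return_pmf Aborted else
     bind_pmf (adv_key_B A st\<^sub>1) (\<lambda>(d\<^sub>2, st\<^sub>2).
     if \<not> authentic f (axu_hash f X\<^sub>B + t\<^sub>2) (3 * bH) d\<^sub>2 then return_pmf Aborted else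
     bind_pmf (adv_key_C A st\<^sub>2 (X\<^sub>C, t\<^sub>3)) (\<lambda>(d\<^sub>3, st\<^sub>3).
     if \<not> authentic f (axu_hash f X\<^sub>C + t\<^sub>3) (3 * bH) d\<^sub>3 then return_pmf Aborted else
     let bob = accepts bM bH (X\<^sub>B + fst d\<^sub>3) doc sig in
     bind_pmf (adv_outcome A st\<^sub>3 (auth_packet f k\<^sub>4 (vec 1 (\<lambda>_. of_bool bob)))) (\<lambda>d\<^sub>4.
     if \<not> authentic f k\<^sub>4 1 d\<^sub>4 then return_pmf Aborted else
     return_pmf (Completed bob (accepts bM bH (X\<^sub>C + fst d\<^sub>2)
       (vec_first (fst d\<^sub>1) bM) (vec_last (fst d\<^sub>1) (2 * bH)))))))))"
    (is "_ = bind_pmf ?F ?R")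
    using t
    by (intro bind_pmf_cong refl)
      (simp only: set_pmf_axu_seeds[OF n] channel_run_def m_def auth_packet_tag)
  moreover have "measure_pmf.prob (bind_pmf ?F ?R) repudiation \<le> ?\<epsilon>"
  proof (intro prob_delivery_le[OF n m] prob_delivery_le[OF n X(1)] prob_delivery_le[OF n X(2)] t
      Aborted_notin_repudiation)
    fix st\<^sub>3
    have "X\<^sub>B + X\<^sub>C = X\<^sub>C + X\<^sub>B"
      using X by (rule comm_add_vec)
    then show "measure_pmf.prob (bind_pmf ?F (\<lambda>f.
       let bob = accepts bM bH (X\<^sub>B + fst (X\<^sub>C, t\<^sub>3)) doc sig in
       bind_pmf (adv_outcome A st\<^sub>3 (auth_packet f k\<^sub>4 (vec 1 (\<lambda>_. of_bool bob)))) (\<lambda>d\<^sub>4.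
       if \<not> authentic f k\<^sub>4 1 d\<^sub>4 then return_pmf Aborted else
       return_pmf (Completed bob (accepts bM bH (X\<^sub>C + fst (X\<^sub>B, t\<^sub>2))
         (vec_first (fst (m, t\<^sub>1)) bM) (vec_last (fst (m, t\<^sub>1)) (2 * bH))))))) repudiation \<le> ?\<epsilon>"
      by (auto intro!: prob_bind_pmf_le simp: Let_def parts measure_return_pmf)
  qed (use bM in auto)
  ultimately show ?thesis
    by simp
qed

theorem mainTheorem4:
  fixes bM bH bH' :: nat
  assumes "bH' \<ge> 1" and "bM > bH"
  shows "repudiation_secure TYPE('st) bM bH bH' (real (2 * bH + bM) / 2 ^ (bH' - 1))"
  unfolding repudiation_secure_def repudiation_def[symmetric]
proof
  fix A :: "'st adversary"
  let ?U = "uniform_bits bH'" and ?F = "pmf_of_set (axu_seeds bH')"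
  show "measure_pmf.prob (protocol_run bM bH bH' A) repudiation \<le> real (2 * bH + bM) / 2 ^ (bH' - 1)"
    unfolding protocol_run_eq
  proof (rule prob_bind_pmf_le, rule prob_bind_pmf_le)
    fix X\<^sub>B X\<^sub>C
    assume X: "X\<^sub>B \<in> set_pmf (uniform_bits (3 * bH))" "X\<^sub>C \<in> set_pmf (uniform_bits (3 * bH))"
    let ?S = "adv_sign A (X\<^sub>B + X\<^sub>C)"
    let ?run = "\<lambda>(doc, sig, st\<^sub>0). channel_run bM bH A X\<^sub>B X\<^sub>C doc sig st\<^sub>0"
    \<comment> \<open>Signing depends on neither seed nor pads and can be drawn first; this fixes
      the message \<open>doc @\<^sub>v sig\<close> before pads are exchanged for tags.\<close>
    have "bind_pmf ?F (\<lambda>f. bind_pmf ?U (\<lambda>k\<^sub>1. bind_pmf ?U (\<lambda>k\<^sub>2. bind_pmf ?U (\<lambda>k\<^sub>3. bind_pmf ?U (\<lambda>k\<^sub>4.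
            bind_pmf ?S (\<lambda>(doc, sig, st\<^sub>0).
              channel_run bM bH A X\<^sub>B X\<^sub>C doc sig st\<^sub>0 f k\<^sub>1 k\<^sub>2 k\<^sub>3 k\<^sub>4))))))
        = bind_pmf ?S (\<lambda>s. bind_pmf ?F (\<lambda>f. bind_pmf ?U (\<lambda>k\<^sub>1. bind_pmf ?U (\<lambda>k\<^sub>2. bind_pmf ?U (\<lambda>k\<^sub>3.
            bind_pmf ?U (\<lambda>k\<^sub>4. ?run s f k\<^sub>1 k\<^sub>2 k\<^sub>3 k\<^sub>4))))))"
      unfolding bind_commute_pmf[of _ ?S] by (simp add: case_prod_beta')
    moreover have "measure_pmf.prob (bind_pmf ?S (\<lambda>s. bind_pmf ?F (\<lambda>f. bind_pmf ?U (\<lambda>k\<^sub>1.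
            bind_pmf ?U (\<lambda>k\<^sub>2. bind_pmf ?U (\<lambda>k\<^sub>3. bind_pmf ?U (\<lambda>k\<^sub>4. ?run s f k\<^sub>1 k\<^sub>2 k\<^sub>3 k\<^sub>4)))))))
          repudiation \<le> real (2 * bH + bM) / 2 ^ (bH' - 1)"
    proof (rule prob_bind_pmf_le)
      fix s assume "s \<in> set_pmf ?S"
      obtain doc sig st\<^sub>0 where s: "s = (doc, sig, st\<^sub>0)"
        by (rule prod_cases3)
      show "measure_pmf.prob (bind_pmf ?F (\<lambda>f. bind_pmf ?U (\<lambda>k\<^sub>1. bind_pmf ?U (\<lambda>k\<^sub>2.
              bind_pmf ?U (\<lambda>k\<^sub>3. bind_pmf ?U (\<lambda>k\<^sub>4. ?run s f k\<^sub>1 k\<^sub>2 k\<^sub>3 k\<^sub>4)))))) repudiation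
            \<le> real (2 * bH + bM) / 2 ^ (bH' - 1)"
        unfolding s prod.case
        \<comment> \<open>The four averaging steps fix the three tags and the last pad, leaving the
          seed as the only draw before the channel run.\<close>
        by (subst pads_to_tags[OF assms(1), of _ "doc @\<^sub>v sig" X\<^sub>B X\<^sub>C])
          (rule prob_bind_pmf_le, rule prob_bind_pmf_le, rule prob_bind_pmf_le, rule prob_bind_pmf_le,
            rule prob_channel_run_le[OF assms], use X in simp_all)
    qed simp
    ultimately show "measure_pmf.prob (bind_pmf ?F (\<lambda>f. bind_pmf ?U (\<lambda>k\<^sub>1. bind_pmf ?U (\<lambda>k\<^sub>2.
            bind_pmf ?U (\<lambda>k\<^sub>3. bind_pmf ?U (\<lambda>k\<^sub>4. bind_pmf ?S (\<lambda>(doc, sig, st\<^sub>0).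
              channel_run bM bH A X\<^sub>B X\<^sub>C doc sig st\<^sub>0 f k\<^sub>1 k\<^sub>2 k\<^sub>3 k\<^sub>4)))))))
          repudiation \<le> real (2 * bH + bM) / 2 ^ (bH' - 1)"
      by simp
  qed simp_all
qed

end
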